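(* For any error rate $0<p<1/2$ and constant $\delta>0$, there is a constant $c_\delta>0$ such that for all large enough $n$ there exist secure sketches $(\mathsf{SS},\mathsf{Rec})$ for $\{0,1\}^n$ with entropy loss $(h(p)+\delta)n$ which correct random errors of rate $p$ except with probability at most $2^{-c_\delta n}$; that is, for every $w\in\{0,1\}^n$, if $W'$ is obtained from $w$ by flipping each bit independently with probability $p$, then $\Pr[\mathsf{Rec}(W',\mathsf{SS}(w))=w]\ge1-2^{-c_\delta n}$. The probability here is taken over the errors only (the distribution on input strings $w$ can be arbitrary).
   Context: Logarithms are base 2; $h(p)=-p\log p-(1-p)\log(1-p)$. Min-entropy: $\mathbf{H}_\infty(A)=-\log\max_a\Pr[A=a]$; average min-entropy: $\tilde{\mathbf{H}}_\infty(A\mid B)=-\log\big(\mathbb{E}_{b\leftarrow B}[\max_a\Pr[A=a\mid B=b]]\big)$. A secure sketch here is a pair of procedures $\mathsf{SS}:\{0,1\}^n\to\{0,1\}^*$ and $\mathsf{Rec}:\{0,1\}^n\times\{0,1\}^*\to\{0,1\}^n$, with the usual worst-case correctness requirement replaced by the probabilistic one in the claim. It has entropy loss $\lambda$ if for every $m$ and every distribution $W$ on $\{0,1\}^n$ with min-entropy at least $m$, $\tilde{\mathbf{H}}_\infty(W\mid\mathsf{SS}(W))\ge m-\lambda$. *)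

theory Defs
  imports "HOL-Probability.Probability"
begin

definition bitstrings :: "nat \<Rightarrow> bool list set" where
  "bitstrings n = {w. length w = n}"

definition bin_entropy :: "real \<Rightarrow> real" where
  "bin_entropy p = - p * log 2 p - (1 - p) * log 2 (1 - p)"

(* The point probabilities of a pmf have a maximum, so the supremum here is that
   maximum; the same applies to the conditional probabilities below. *)
definition min_entropy :: "'a pmf \<Rightarrow> real" where
  "min_entropy A = - log 2 (SUP a. pmf A a)"

(* AB is the joint distribution of the pair (A, B). *)
definition avg_min_entropy :: "('a \<times> 'b) pmf \<Rightarrow> real" where
  "avg_min_entropy AB =
     - log 2 (measure_pmf.expectation (map_pmf snd AB)
                (\<lambda>b. SUP a. \<P>(x in measure_pmf AB. fst x = a \<bar> snd x = b)))"

(* SS and Rec are deterministic, and only their values on inputs from {0,1}^n matter.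
   SS has codomain {0,1}^*, the full type bool list, so only Rec is constrained. *)
definition sketch_pair ::
  "nat \<Rightarrow> (bool list \<Rightarrow> bool list) \<Rightarrow> (bool list \<Rightarrow> bool list \<Rightarrow> bool list) \<Rightarrow> bool" where
  "sketch_pair n SS Rec \<longleftrightarrow> (\<forall>w \<in> bitstrings n. \<forall>s. Rec w s \<in> bitstrings n)"

definition has_entropy_loss :: "nat \<Rightarrow> (bool list \<Rightarrow> bool list) \<Rightarrow> real \<Rightarrow> bool" where
  "has_entropy_loss n SS l \<longleftrightarrow>
     (\<forall>(m::real) (W::bool list pmf).
        set_pmf W \<subseteq> bitstrings n \<longrightarrow> min_entropy W \<ge> m \<longrightarrow>
        avg_min_entropy (map_pmf (\<lambda>w. (w, SS w)) W) \<ge> m - l)"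

(* On bool, disequality is exclusive or. *)
definition flip_bits :: "real \<Rightarrow> bool list \<Rightarrow> bool list pmf" where
  "flip_bits p w =
     map_pmf (\<lambda>e. map2 (\<noteq>) w e) (replicate_pmf (length w) (bernoulli_pmf p))"

definition corrects_random_errors ::
  "nat \<Rightarrow> (bool list \<Rightarrow> bool list) \<Rightarrow> (bool list \<Rightarrow> bool list \<Rightarrow> bool list)
     \<Rightarrow> real \<Rightarrow> real \<Rightarrow> bool" where
  "corrects_random_errors n SS Rec p \<epsilon> \<longleftrightarrow>
     (\<forall>w \<in> bitstrings n.
        measure_pmf.prob (flip_bits p w) {w'. Rec w' (SS w) = w} \<ge> 1 - \<epsilon>)"

end

theory Submission
  imports Defs
begin

text \<open>
  The sketch is the syndrome of w under a binary matrix H with k rows, where k is (h(p) + \<delta>) n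
  rounded down. Its values have k bits, so it loses at most k bits of entropy. By linearity, the
  syndromes of w and of w' determine the syndrome of the error pattern e, so recovery fails only if
  the weight of e exceeds (p + \<eta>) n, which is exponentially unlikely by Hoeffding's inequality, or
  if another pattern of at most this weight has the syndrome of e; neither event depends on w. For
  small \<eta> there are at most 2 to the power (h(p) + \<delta>/2) n such patterns, and each of them collides
  with e for a 2 to the power -k fraction of all matrices, so some H makes the second event
  exponentially unlikely as well.
\<close>

section \<open>Exclusive or and inner products of bit strings\<close>

definition xor_bits :: "bool list \<Rightarrow> bool list \<Rightarrow> bool list" (infixl "\<oplus>" 65) where
  "x \<oplus> y = map2 (\<noteq>) x y"

lemma xor_bits_simps [simp]:
  "[] \<oplus> y = []" "x \<oplus> [] = []" "(a # x) \<oplus> (b # y) = (a \<noteq> b) # (x \<oplus> y)"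
  by (simp_all add: xor_bits_def)

lemma length_xor_bits [simp]: "length (x \<oplus> y) = min (length x) (length y)"
  by (simp add: xor_bits_def)

text \<open>This is the inner product over the field with two elements.\<close>

fun parity :: "bool list \<Rightarrow> bool list \<Rightarrow> bool" where
  "parity (a # r) (b # x) = ((a \<and> b) \<noteq> parity r x)"
| "parity _ _ = False"

lemma parity_xor_right:
  assumes "length r = length x" "length x = length y"
  shows "parity r (x \<oplus> y) = (parity r x \<noteq> parity r y)"
  using assms by (induction r x y rule: list_induct3) auto

lemma parity_xor_left:
  assumes "length x = length y" "length y = length r"
  shows "parity (x \<oplus> y) r = (parity x r \<noteq> parity y r)"
  using assms by (induction x y r rule: list_induct3) auto

lemma xor_bits_cancel_right:
  assumes "length x = length y"
  shows "x \<oplus> y \<oplus> y = x"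
  using assms by (induction x y rule: list_induct2) auto

lemma xor_bits_cancel_left:
  assumes "length x = length y"
  shows "x \<oplus> (x \<oplus> y) = y"
  using assms by (induction x y rule: list_induct2) auto

lemma xor_bits_assoc: "x \<oplus> y \<oplus> z = x \<oplus> (y \<oplus> z)"
proof (induction x arbitrary: y z)
  case (Cons a x)
  then show ?case by (cases y; cases z) auto
qed auto

text \<open>The unit vector at the last position where \<open>x\<close> and \<open>y\<close> differ
  is such a \<open>u\<close>.\<close>

lemma ex_parity:
  assumes "length x = length y" "x \<noteq> y"
  obtains u where "length u = length x" "parity u (x \<oplus> y)"
proof -
  have "\<exists>u. length u = length x \<and> parity u (x \<oplus> y)"
    using assms
  proof (induction x y rule: list_induct2)
    case (Cons a x b y)
    show ?case
    proof (cases "x = y")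
      case True
      have "\<not> parity (replicate k False) z" for k z
      proof (induction k arbitrary: z)
        case (Suc k)
        then show ?case by (cases z) auto
      qed simp
      then show ?thesis
        using True Cons by (intro exI[of _ "True # replicate (length x) False"]) auto
    next
      case False
      with Cons obtain u where "length u = length x" "parity u (x \<oplus> y)" by auto
      then show ?thesis by (intro exI[of _ "False # u"]) auto
    qed
  qed auto
  then show ?thesis using that by blast
qed

section \<open>Matrices that annihilate a given nonzero vector\<close>

lemma finite_bitstrings [simp]: "finite (bitstrings n)"
  and card_bitstrings: "card (bitstrings n) = 2 ^ n"
  using finite_lists_length_eq[of "UNIV :: bool set" n] card_lists_length_eq[of "UNIV :: bool set" n]
  by (auto simp: bitstrings_def)

text \<open>Adding a vector outside the kernel maps the kernel injectively into its complement.\<close>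
lemma card_parity_kernel:
  assumes x: "x \<in> bitstrings n" and y: "y \<in> bitstrings n" and "x \<noteq> y"
  shows "2 * card {r \<in> bitstrings n. \<not> parity r (x \<oplus> y)} \<le> 2 ^ n"
proof -
  let ?K = "{r \<in> bitstrings n. \<not> parity r (x \<oplus> y)}"
  obtain u where u: "length u = n" "parity u (x \<oplus> y)"
    using ex_parity[of x y] assms by (auto simp: bitstrings_def)
  have "card ?K \<le> card (bitstrings n - ?K)"
  proof (rule card_inj_on_le)
    show "inj_on (\<lambda>r. r \<oplus> u) ?K"
      by (rule inj_on_inverseI[where g = "\<lambda>r. r \<oplus> u"])
         (use u in \<open>simp add: bitstrings_def xor_bits_cancel_right\<close>)
    show "(\<lambda>r. r \<oplus> u) ` ?K \<subseteq> bitstrings n - ?K"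
      using u x y by (auto simp: bitstrings_def parity_xor_left)
  qed simp
  also have "\<dots> = card (bitstrings n) - card ?K"
    by (rule card_Diff_subset) auto
  finally show ?thesis
    using card_mono[of "bitstrings n" ?K] by (simp add: card_bitstrings)
qed

text \<open>A matrix is the list of its rows.\<close>
definition matrices :: "nat \<Rightarrow> nat \<Rightarrow> bool list list set" where
  "matrices k n = {H. set H \<subseteq> bitstrings n \<and> length H = k}"

lemma finite_matrices [simp]: "finite (matrices k n)"
  and card_matrices: "card (matrices k n) = (2 ^ n) ^ k"
  by (simp_all add: matrices_def finite_lists_length_eq card_lists_length_eq card_bitstrings)

text \<open>The rows are chosen independently, and each is orthogonal to \<open>x \<oplus> y\<close>
  for at most half of the choices.\<close>

lemma card_matrices_kernel:
  assumes "x \<in> bitstrings n" "y \<in> bitstrings n" "x \<noteq> y"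
  shows "2 ^ k * card {H \<in> matrices k n. \<forall>r\<in>set H. \<not> parity r (x \<oplus> y)} \<le> card (matrices k n)"
proof -
  let ?K = "{r \<in> bitstrings n. \<not> parity r (x \<oplus> y)}"
  have "{H \<in> matrices k n. \<forall>r\<in>set H. \<not> parity r (x \<oplus> y)} = {H. set H \<subseteq> ?K \<and> length H = k}"
    by (auto simp: matrices_def)
  then have "2 ^ k * card {H \<in> matrices k n. \<forall>r\<in>set H. \<not> parity r (x \<oplus> y)} = (2 * card ?K) ^ k"
    by (simp add: card_lists_length_eq power_mult_distrib)
  also have "\<dots> \<le> (2 ^ n) ^ k"
    by (rule power_mono[OF card_parity_kernel[OF assms]]) simp
  finally show ?thesis by (simp add: card_matrices)
qed

section \<open>Choosing a good matrix\<close>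

text \<open>For words as long as the rows, the condition on the rows says that \<open>e'\<close> and
  \<open>e\<close> have the same syndrome. The set \<open>T\<close> holds the error patterns that
  the decoder considers.\<close>

definition ambiguous :: "bool list set \<Rightarrow> bool list list \<Rightarrow> bool list set" where
  "ambiguous T H = {e. \<exists>e'\<in>T. e' \<noteq> e \<and> (\<forall>r\<in>set H. \<not> parity r (e' \<oplus> e))}"

text \<open>First-moment argument: the bound holds on average over a uniformly chosen matrix, hence
  for some matrix. The distribution \<open>E\<close> is fixed first, so one matrix serves all error
  patterns at once.\<close>

lemma ex_matrix_ambiguous_small:
  fixes E :: "bool list pmf"
  assumes E: "set_pmf E \<subseteq> bitstrings n" and T: "T \<subseteq> bitstrings n"
  obtains H where "H \<in> matrices k n"
    "measure_pmf.prob E (ambiguous T H) \<le> real (card T) / 2 ^ k"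
proof -
  let ?B = "bitstrings n" and ?M = "matrices k n"
  define Z where "Z e e' = {H \<in> ?M. \<forall>r\<in>set H. \<not> parity r (e' \<oplus> e)}" for e e'
  have finT: "finite T" using T finite_subset finite_bitstrings by blast
  have prob: "measure_pmf.prob E (ambiguous T H) = (\<Sum>e\<in>?B. pmf E e * of_bool (e \<in> ambiguous T H))" for H
  proof -
    have "measure_pmf.prob E (ambiguous T H) = measure_pmf.prob E (ambiguous T H \<inter> ?B)"
      by (rule measure_eq_AE) (use E in \<open>auto simp: AE_measure_pmf_iff\<close>)
    also have "\<dots> = (\<Sum>e\<in>ambiguous T H \<inter> ?B. pmf E e)"
      by (simp add: measure_measure_pmf_finite)
    also have "\<dots> = (\<Sum>e\<in>?B. pmf E e * of_bool (e \<in> ambiguous T H))"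
      by (rule sum.mono_neutral_cong_left) auto
    finally show ?thesis .
  qed
  \<comment> \<open>Union bound for a fixed \<open>e\<close>: each competitor in \<open>T\<close>
    collides with it for at most a \<open>1 / 2 ^ k\<close> fraction of the matrices.\<close>
  have bad: "(\<Sum>H\<in>?M. of_bool (e \<in> ambiguous T H)) \<le> real (card T) * (card ?M / 2 ^ k)"
    if e: "e \<in> ?B" for e
  proof -
    have "(\<Sum>H\<in>?M. of_bool (e \<in> ambiguous T H)) = real (card {H \<in> ?M. e \<in> ambiguous T H})"
      by (simp add: of_bool_def sum.If_cases Int_def)
    also have "card {H \<in> ?M. e \<in> ambiguous T H} \<le> card (\<Union>e'\<in>T - {e}. Z e e')"
      by (rule card_mono) (use finT in \<open>auto simp: Z_def ambiguous_def\<close>)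
    also have "\<dots> \<le> (\<Sum>e'\<in>T - {e}. card (Z e e'))"
      by (rule card_UN_le) (use finT in simp)
    also have "real \<dots> \<le> (\<Sum>e'\<in>T - {e}. card ?M / 2 ^ k)"
      unfolding of_nat_sum
    proof (rule sum_mono)
      fix e' assume "e' \<in> T - {e}"
      then have "2 ^ k * card (Z e e') \<le> card ?M"
        unfolding Z_def using e T by (intro card_matrices_kernel) auto
      then have "real (2 ^ k * card (Z e e')) \<le> real (card ?M)"
        by (rule of_nat_mono)
      then show "real (card (Z e e')) \<le> card ?M / 2 ^ k"
        by (simp add: field_simps)
    qed
    also have "\<dots> = real (card (T - {e})) * (card ?M / 2 ^ k)" by simp
    also have "\<dots> \<le> real (card T) * (card ?M / 2 ^ k)"
      by (intro mult_right_mono of_nat_mono card_mono) (use finT in auto)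
    finally show ?thesis by simp
  qed
  have "(\<Sum>H\<in>?M. measure_pmf.prob E (ambiguous T H)) =
      (\<Sum>e\<in>?B. pmf E e * (\<Sum>H\<in>?M. of_bool (e \<in> ambiguous T H)))"
    unfolding prob sum_distrib_left by (rule sum.swap)
  also have "\<dots> \<le> (\<Sum>e\<in>?B. pmf E e * (real (card T) * (card ?M / 2 ^ k)))"
    by (intro sum_mono mult_left_mono bad) auto
  also have "\<dots> = real (card T) * (card ?M / 2 ^ k)"
    using E by (simp only: sum_distrib_right[symmetric] sum_pmf_eq_1 finite_bitstrings mult_1)
  finally have avg: "(\<Sum>H\<in>?M. measure_pmf.prob E (ambiguous T H)) \<le> (\<Sum>H\<in>?M. real (card T) / 2 ^ k)"
    by (simp add: mult.commute)
  \<comment> \<open>Not every term can exceed the average, as there is at least one matrix.\<close>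
  have "\<exists>H\<in>?M. measure_pmf.prob E (ambiguous T H) \<le> real (card T) / 2 ^ k"
  proof (rule ccontr)
    assume "\<not> ?thesis"
    moreover have "?M \<noteq> {}"
      using card_matrices[of k n] by (metis card.empty power_not_zero zero_neq_numeral)
    ultimately have "(\<Sum>H\<in>?M. real (card T) / 2 ^ k) < (\<Sum>H\<in>?M. measure_pmf.prob E (ambiguous T H))"
      by (intro sum_strict_mono) (auto simp: not_le)
    with avg show False by simp
  qed
  then show ?thesis using that by blast
qed

section \<open>The sketch and its decoder\<close>

definition syndrome :: "bool list list \<Rightarrow> bool list \<Rightarrow> bool list" where
  "syndrome H w = map (\<lambda>r. parity r w) H"

text \<open>Here \<open>v \<oplus> w'\<close> is the error pattern that would turn \<open>v\<close>
  into \<open>w'\<close>. The fallback \<open>w'\<close> keeps the output at the right length when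
  no candidate fits an arbitrary \<open>s\<close>.\<close>

definition decode :: "bool list set \<Rightarrow> bool list list \<Rightarrow> bool list \<Rightarrow> bool list \<Rightarrow> bool list" where
  "decode T H w' s =
     (if \<exists>v\<in>bitstrings (length w'). syndrome H v = s \<and> v \<oplus> w' \<in> T
      then SOME v. v \<in> bitstrings (length w') \<and> syndrome H v = s \<and> v \<oplus> w' \<in> T
      else w')"

lemma sketch_pair_decode: "sketch_pair n SS (decode T H)"
  unfolding sketch_pair_def
proof (intro ballI allI)
  fix w s assume w: "w \<in> bitstrings n"
  show "decode T H w s \<in> bitstrings n"
  proof (cases "\<exists>v\<in>bitstrings (length w). syndrome H v = s \<and> v \<oplus> w \<in> T")
    case True
    then have "\<exists>v. v \<in> bitstrings (length w) \<and> syndrome H v = s \<and> v \<oplus> w \<in> T" by blast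
    from someI_ex[OF this] True w show ?thesis by (simp add: decode_def bitstrings_def)
  qed (use w in \<open>auto simp: decode_def\<close>)
qed

text \<open>The word \<open>w\<close> is a candidate because its error pattern is \<open>e\<close>.
  The pattern of any other candidate would be a second element of \<open>T\<close> with the syndrome
  of \<open>e\<close>.\<close>

lemma decode_correct:
  assumes H: "H \<in> matrices k n" and w: "w \<in> bitstrings n" and e: "e \<in> bitstrings n"
    and eT: "e \<in> T" and unamb: "e \<notin> ambiguous T H"
  shows "decode T H (w \<oplus> e) (syndrome H w) = w"
proof -
  let ?P = "\<lambda>v. v \<in> bitstrings (length (w \<oplus> e)) \<and> syndrome H v = syndrome H w \<and> v \<oplus> (w \<oplus> e) \<in> T"
  have len: "length w = n" "length e = n" using w e by (auto simp: bitstrings_def)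
  have P: "?P w" using len eT by (simp add: bitstrings_def xor_bits_cancel_left)
  have unique: "v = w" if "?P v" for v
  proof -
    have lv: "length v = n" using that len by (simp add: bitstrings_def)
    have "\<not> parity r (v \<oplus> (w \<oplus> e) \<oplus> e)" if r: "r \<in> set H" for r
    proof -
      have "length r = n" using r H by (auto simp: matrices_def bitstrings_def)
      moreover have "parity r v = parity r w"
        using \<open>?P v\<close> r by (auto simp: syndrome_def)
      ultimately show ?thesis using len lv by (auto simp: parity_xor_right)
    qed
    with unamb that have "v \<oplus> (w \<oplus> e) = e" unfolding ambiguous_def by blast
    \<comment> \<open>The word \<open>e \<oplus> e\<close> stands for the zero vector, so the next
      equation amounts to \<open>v = w\<close>.\<close>
    then have "v \<oplus> w \<oplus> e \<oplus> e = e \<oplus> e" by (simp only: xor_bits_assoc)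
    then have vw: "v \<oplus> w = e \<oplus> e" using len lv by (simp add: xor_bits_cancel_right)
    have "v \<oplus> (v \<oplus> w) = v \<oplus> e \<oplus> e" using vw by (simp only: xor_bits_assoc)
    then show ?thesis using len lv by (simp add: xor_bits_cancel_left xor_bits_cancel_right)
  qed
  have "\<exists>v\<in>bitstrings (length (w \<oplus> e)). syndrome H v = syndrome H w \<and> v \<oplus> (w \<oplus> e) \<in> T"
    using P by blast
  moreover have "(SOME v. ?P v) = w"
    using P unique by (intro some_equality)
  ultimately show ?thesis unfolding decode_def by (simp only: if_True)
qed

lemma set_flip_noise: "set_pmf (replicate_pmf n (bernoulli_pmf p)) \<subseteq> bitstrings n"
  by (auto simp: set_replicate_pmf bitstrings_def)

text \<open>The failure event is a set of error patterns that does not mention \<open>w\<close>, so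
  a single bound covers every input.\<close>

lemma corrects_random_errors_decode:
  assumes H: "H \<in> matrices k n"
    and eps: "measure_pmf.prob (replicate_pmf n (bernoulli_pmf p)) (- T \<union> ambiguous T H) \<le> \<epsilon>"
  shows "corrects_random_errors n (syndrome H) (decode T H) p \<epsilon>"
  unfolding corrects_random_errors_def
proof
  fix w assume w: "w \<in> bitstrings n"
  let ?E = "replicate_pmf n (bernoulli_pmf p)"
  let ?bad = "- T \<union> ambiguous T H"
  have "1 - \<epsilon> \<le> 1 - measure_pmf.prob ?E ?bad" using eps by simp
  also have "\<dots> = measure_pmf.prob ?E (- ?bad)"
    using measure_pmf.prob_compl[of ?bad ?E] by (simp add: Compl_eq_Diff_UNIV)
  also have "\<dots> \<le> measure_pmf.prob ?E {e. decode T H (w \<oplus> e) (syndrome H w) = w}"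
  proof (rule measure_pmf.finite_measure_mono_AE)
    show "AE e in ?E. e \<in> - ?bad \<longrightarrow> e \<in> {e. decode T H (w \<oplus> e) (syndrome H w) = w}"
      using set_flip_noise decode_correct[OF H w] by (fastforce simp: AE_measure_pmf_iff)
  qed simp
  also have "\<dots> = measure_pmf.prob (flip_bits p w) {w'. decode T H w' (syndrome H w) = w}"
    using w by (simp add: flip_bits_def bitstrings_def vimage_def xor_bits_def)
  finally show "1 - \<epsilon> \<le> measure_pmf.prob (flip_bits p w) {w'. decode T H w' (syndrome H w) = w}" .
qed

section \<open>Entropy loss of a sketch with few values\<close>

lemma bdd_above_pmf: "bdd_above (range (pmf A))"
  by (rule bdd_aboveI[of _ 1]) (auto simp: pmf_le_1)

text \<open>Each value of the sketch contributes at most the largest point probability of W to the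
  expected guessing probability.\<close>
lemma has_entropy_loss_card:
  assumes range: "SS ` bitstrings n \<subseteq> S" "finite S" "real (card S) \<le> 2 powr l"
  shows "has_entropy_loss n SS l"
  unfolding has_entropy_loss_def
proof (intro allI impI)
  fix m :: real and W :: "bool list pmf"
  assume W: "set_pmf W \<subseteq> bitstrings n" and m: "m \<le> min_entropy W"
  define AB where "AB = map_pmf (\<lambda>w. (w, SS w)) W"
  define M where "M = (SUP a. pmf W a)"
  define G where "G b = (SUP a. \<P>(x in measure_pmf AB. fst x = a \<bar> snd x = b))" for b
  define B where "B = map_pmf snd AB"
  have le_M: "pmf W a \<le> M" for a
    unfolding M_def by (rule cSUP_upper[OF _ bdd_above_pmf]) simp
  obtain a0 where a0: "a0 \<in> set_pmf W" using set_pmf_not_empty[of W] by blast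
  have M_pos: "M > 0" using le_M[of a0] a0 pmf_positive[OF a0] by linarith
  \<comment> \<open>The sketch is a function of \<open>w\<close>, so the joint event contains at
    most the one point \<open>a\<close>. If \<open>b\<close> has probability 0, both sides are 0 by
    division by zero.\<close>
  have cond: "\<P>(x in measure_pmf AB. fst x = a \<bar> snd x = b) = of_bool (SS a = b) * pmf W a / pmf B b" for a b
  proof -
    have "measure_pmf.prob AB {x. fst x = a \<and> snd x = b} = measure_pmf.prob W (if SS a = b then {a} else {})"
      unfolding AB_def measure_map_pmf by (rule arg_cong[of _ _ "measure_pmf.prob W"]) auto
    moreover have "measure_pmf.prob AB {x. snd x = b} = pmf B b"
      by (simp add: B_def pmf_map vimage_def)
    ultimately show ?thesis by (simp add: cond_prob_def measure_pmf_single)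
  qed
  \<comment> \<open>The weight of \<open>b\<close> in the expectation cancels the denominator of the
    conditional probability.\<close>
  have G_le: "pmf B b * G b \<le> M" for b
  proof (cases "pmf B b = 0")
    case False
    then have pos: "pmf B b > 0" by (simp add: order_less_le)
    have "G b \<le> M / pmf B b"
      unfolding G_def cond
      by (rule cSUP_least) (use le_M M_pos in \<open>auto intro!: divide_right_mono\<close>)
    with pos show ?thesis by (simp add: field_simps)
  qed (use M_pos in simp)
  have G_ge: "of_bool (SS a = b) * pmf W a / pmf B b \<le> G b" for a b
    unfolding G_def cond
  proof (rule cSUP_upper)
    show "bdd_above (range (\<lambda>a. of_bool (SS a = b) * pmf W a / pmf B b))"
      using le_M M_pos by (intro bdd_aboveI[of _ "M / pmf B b"]) (auto intro!: divide_right_mono)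
  qed simp
  have G_nonneg: "G b \<ge> 0" for b
    by (rule order_trans[OF _ G_ge[of a0 b]]) simp
  have setB: "set_pmf B = SS ` set_pmf W"
    by (force simp: B_def AB_def)
  have setB_S: "set_pmf B \<subseteq> S" using range W setB by auto
  have expect: "measure_pmf.expectation B G = (\<Sum>b\<in>S. pmf B b * G b)"
    by (subst integral_measure_pmf[OF \<open>finite S\<close>]) (use setB_S in auto)
  also have "\<dots> \<le> (\<Sum>b\<in>S. M)" by (intro sum_mono G_le)
  also have "\<dots> \<le> 2 powr l * M" using range(3) M_pos by simp
  finally have upper: "measure_pmf.expectation B G \<le> 2 powr l * M" .
  have in_B: "SS a0 \<in> set_pmf B" using a0 setB by auto
  \<comment> \<open>Monotonicity of the logarithm needs a positive expectation; a single point
    \<open>a0\<close> in the support of \<open>W\<close> provides it.\<close>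
  have "0 < pmf B (SS a0) * G (SS a0)"
    using G_ge[of a0 "SS a0"] pmf_positive[OF a0] pmf_positive[OF in_B]
    by (intro mult_pos_pos) (auto elim!: order.strict_trans2[rotated])
  also have "\<dots> \<le> measure_pmf.expectation B G"
    unfolding expect
    by (rule member_le_sum[of _ S "\<lambda>b. pmf B b * G b"])
       (use in_B setB_S G_nonneg \<open>finite S\<close> in auto)
  finally have "log 2 (measure_pmf.expectation B G) \<le> log 2 (2 powr l * M)"
    using upper by (intro log_mono) auto
  also have "\<dots> = l + log 2 M" using M_pos by (simp add: log_mult)
  finally have "m - l \<le> - log 2 (measure_pmf.expectation B G)"
    using m by (simp add: min_entropy_def M_def)
  then show "m - l \<le> avg_min_entropy (map_pmf (\<lambda>w. (w, SS w)) W)"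
    by (simp add: avg_min_entropy_def AB_def[symmetric] B_def G_def[abs_def])
qed

lemma has_entropy_loss_syndrome:
  assumes "H \<in> matrices k n" "real k \<le> l"
  shows "has_entropy_loss n (syndrome H) l"
proof (rule has_entropy_loss_card)
  show "syndrome H ` bitstrings n \<subseteq> bitstrings k"
    using assms by (auto simp: bitstrings_def syndrome_def matrices_def)
  show "real (card (bitstrings k)) \<le> 2 powr l"
    using assms by (simp add: card_bitstrings flip: powr_realpow)
qed simp

section \<open>Weight of the error pattern\<close>

lemma pmf_replicate_bernoulli:
  assumes "0 \<le> p" "p \<le> 1"
  shows "pmf (replicate_pmf (length e) (bernoulli_pmf p)) e =
    p ^ count_list e True * (1 - p) ^ (length e - count_list e True)"
proof (induction e)
  case (Cons a e)
  have "replicate_pmf (length (a # e)) (bernoulli_pmf p) =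
      map_pmf (\<lambda>(x, xs). x # xs) (pair_pmf (bernoulli_pmf p) (replicate_pmf (length e) (bernoulli_pmf p)))"
    by (simp add: pair_pmf_def map_bind_pmf)
  then have "pmf (replicate_pmf (length (a # e)) (bernoulli_pmf p)) (a # e) =
      pmf (bernoulli_pmf p) a * pmf (replicate_pmf (length e) (bernoulli_pmf p)) e"
    using pmf_map_inj'[of "\<lambda>(x, xs). x # xs" _ "(a, e)"]
    by (simp add: pmf_pair inj_def)
  then show ?case
    using Cons assms count_le_length[of e True] by (cases a) (simp_all add: Suc_diff_le)
qed simp

text \<open>This is the Hamming ball around the zero word. The radius is real, so
  \<open>(p + \<eta>) * n\<close> needs no rounding.\<close>

definition light :: "nat \<Rightarrow> real \<Rightarrow> bool list set" where
  "light n t = {e \<in> bitstrings n. real (count_list e True) \<le> t}"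

lemma count_list_True: "count_list e True = length (filter id e)"
  by (induction e) auto

text \<open>The weight of the noise is binomially distributed with mean \<open>n * p\<close>, and
  Hoeffding's inequality applies to the deviation \<open>\<eta> * n\<close>.\<close>

lemma prob_not_light:
  assumes p: "0 \<le> p" "p \<le> 1" and n: "n > 0" and \<eta>: "\<eta> \<ge> 0"
  shows "measure_pmf.prob (replicate_pmf n (bernoulli_pmf p)) (- light n ((p + \<eta>) * n)) \<le> exp (- 2 * \<eta>\<^sup>2 * n)"
proof -
  interpret binomial_distribution n p using p by unfold_locales auto
  let ?E = "replicate_pmf n (bernoulli_pmf p)"
  have "measure_pmf.prob ?E (- light n ((p + \<eta>) * n)) \<le>
      measure_pmf.prob ?E {e. real (length (filter id e)) \<ge> n * p + \<eta> * n}"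
    by (rule measure_pmf.finite_measure_mono_AE)
       (use set_flip_noise[of n p] in
         \<open>auto simp: AE_measure_pmf_iff light_def count_list_True algebra_simps\<close>)
  also have "\<dots> = measure_pmf.prob (binomial_pmf n p) {x. real x \<ge> n * p + \<eta> * n}"
    using p by (simp add: binomial_pmf_altdef vimage_def)
  also have "\<dots> \<le> exp (- 2 * (\<eta> * n)\<^sup>2 / n)"
    by (rule prob_ge) (use n \<eta> in auto)
  also have "\<dots> = exp (- 2 * \<eta>\<^sup>2 * n)"
    using n by (simp add: power2_eq_square)
  finally show ?thesis .
qed

text \<open>Since p is at most 1/2, the probability of a word decreases with its weight. So every word counted
  here has at least the probability that corresponds to weight (p + \<eta>) n, and the probabilities add up
  to at most 1.\<close>
lemma card_light_le:
  assumes p: "0 < p" "p \<le> 1/2"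
  shows "real (card (light n ((p + \<eta>) * n))) \<le> 2 powr ((bin_entropy p + \<eta> * log 2 ((1 - p) / p)) * n)"
proof -
  let ?E = "replicate_pmf n (bernoulli_pmf p)" and ?T = "light n ((p + \<eta>) * n)"
  define x where "x = (bin_entropy p + \<eta> * log 2 ((1 - p) / p)) * n"
  let ?q = "2 powr (- x)"
  have q: "?q \<le> pmf ?E e" if e: "e \<in> ?T" for e
  proof -
    define j where "j = count_list e True"
    have len: "length e = n" and j: "real j \<le> (p + \<eta>) * n" "j \<le> n"
      using e count_le_length[of e True] by (auto simp: light_def bitstrings_def j_def)
    have L: "log 2 ((1 - p) / p) = log 2 (1 - p) - log 2 p"
      using p by (simp add: log_divide)
    have L_nonneg: "log 2 (1 - p) - log 2 p \<ge> 0" using p by simp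
    \<comment> \<open>The logarithm of the probability of a word is affine and nonincreasing in its
      weight; \<open>- x\<close> is its value at weight \<open>(p + \<eta>) * n\<close>, whether or
      not this is an integer.\<close>
    have "- x = n * log 2 (1 - p) - (p + \<eta>) * n * (log 2 (1 - p) - log 2 p)"
      unfolding x_def bin_entropy_def L by (simp add: algebra_simps)
    also have "\<dots> \<le> n * log 2 (1 - p) - j * (log 2 (1 - p) - log 2 p)"
      using mult_right_mono[OF j(1) L_nonneg] by linarith
    also have "\<dots> = j * log 2 p + (n - j) * log 2 (1 - p)"
      using j by (simp add: algebra_simps)
    also have "\<dots> = log 2 (p ^ j * (1 - p) ^ (n - j))"
      using p by (simp add: log_mult log_nat_power)
    finally have "?q \<le> 2 powr log 2 (p ^ j * (1 - p) ^ (n - j))"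
      by (intro powr_mono) auto
    also have "\<dots> = pmf ?E e"
      using pmf_replicate_bernoulli[of p e] p by (simp add: len j_def)
    finally show ?thesis .
  qed
  have fin: "finite ?T" by (simp add: light_def)
  have "card ?T * ?q = (\<Sum>e\<in>?T. ?q)" by simp
  also have "\<dots> \<le> (\<Sum>e\<in>?T. pmf ?E e)" by (intro sum_mono q)
  also have "\<dots> \<le> 1"
    using fin by (metis measure_measure_pmf_finite measure_pmf.prob_le_1)
  finally show ?thesis unfolding x_def[symmetric] by (simp add: powr_minus field_simps)
qed

section \<open>Choice of parameters\<close>

text \<open>The two error terms bound the event that the noise is too heavy and the event that it is
  ambiguous. The choice of \<open>\<eta>\<close> spends half of the slack \<open>\<delta>\<close> on
  enlarging the ball beyond radius \<open>p * n\<close>; the other half makes collisions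
  rare.\<close>

lemma ex_sketch:
  fixes p \<delta> :: real
  assumes p: "0 < p" "p < 1/2" and n: "n > 0" and \<delta>: "\<delta> > 0"
  defines "\<eta> \<equiv> \<delta> / (2 * log 2 ((1 - p) / p))"
  shows "\<exists>SS Rec. sketch_pair n SS Rec
             \<and> has_entropy_loss n SS ((bin_entropy p + \<delta>) * real n)
             \<and> corrects_random_errors n SS Rec p (exp (- 2 * \<eta>\<^sup>2 * n) + 2 * 2 powr (- (\<delta> / 2) * n))"
proof -
  have L: "log 2 ((1 - p) / p) > 0" using p by (simp add: field_simps)
  then have \<eta>: "\<eta> \<ge> 0" "\<eta> * log 2 ((1 - p) / p) = \<delta> / 2" using \<delta> by (auto simp: \<eta>_def)
  \<comment> \<open>Nonnegative entropy makes \<open>l\<close> nonnegative, so that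
    \<open>nat\<close> does not truncate the floor below.\<close>
  have "p * log 2 p \<le> 0" "(1 - p) * log 2 (1 - p) \<le> 0"
    using p by (auto intro!: mult_nonneg_nonpos)
  then have h: "bin_entropy p \<ge> 0" unfolding bin_entropy_def by linarith
  define l where "l = (bin_entropy p + \<delta>) * real n"
  have l: "l \<ge> 0" using h \<delta> by (simp add: l_def)
  define k where "k = nat \<lfloor>l\<rfloor>"
  have k: "real k \<le> l" "l \<le> real k + 1" using l by (auto simp: k_def)
  let ?E = "replicate_pmf n (bernoulli_pmf p)"
  define T where "T = light n ((p + \<eta>) * n)"
  obtain H where H: "H \<in> matrices k n" and amb: "measure_pmf.prob ?E (ambiguous T H) \<le> real (card T) / 2 ^ k"
    using ex_matrix_ambiguous_small[OF set_flip_noise[of n p], of T] by (auto simp: T_def light_def)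
  \<comment> \<open>Rounding \<open>l\<close> down loses less than one row, which costs the factor 2
    in the collision term.\<close>
  have "real (card T) / 2 ^ k \<le> 2 powr ((bin_entropy p + \<delta> / 2) * n) / 2 powr (l - 1)"
  proof (rule frac_le)
    show "real (card T) \<le> 2 powr ((bin_entropy p + \<delta> / 2) * n)"
      using card_light_le[of p n \<eta>] p \<eta> by (simp add: T_def)
    show "2 powr (l - 1) \<le> 2 ^ k" using k by (simp flip: powr_realpow)
  qed auto
  also have "\<dots> = 2 powr ((bin_entropy p + \<delta> / 2) * n - (l - 1))"
    by (simp add: powr_diff)
  also have "(bin_entropy p + \<delta> / 2) * n - (l - 1) = 1 + - (\<delta> / 2) * n"
    by (simp add: l_def field_simps)
  also have "2 powr (1 + - (\<delta> / 2) * n) = 2 * 2 powr (- (\<delta> / 2) * n)"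
    unfolding powr_add by simp
  finally have amb': "measure_pmf.prob ?E (ambiguous T H) \<le> 2 * 2 powr (- (\<delta> / 2) * n)"
    using amb by linarith
  have "measure_pmf.prob ?E (- T \<union> ambiguous T H)
      \<le> measure_pmf.prob ?E (- T) + measure_pmf.prob ?E (ambiguous T H)"
    by (rule measure_Un_le) auto
  also have "\<dots> \<le> exp (- 2 * \<eta>\<^sup>2 * n) + 2 * 2 powr (- (\<delta> / 2) * n)"
    unfolding T_def using amb'[unfolded T_def] p n \<eta> by (intro add_mono prob_not_light) auto
  finally have "corrects_random_errors n (syndrome H) (decode T H) p (exp (- 2 * \<eta>\<^sup>2 * n) + 2 * 2 powr (- (\<delta> / 2) * n))"
    by (rule corrects_random_errors_decode[OF H])
  then show ?thesis
    using sketch_pair_decode has_entropy_loss_syndrome[OF H k(1)] unfolding l_def by blast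
qed

lemma corrects_random_errors_mono:
  "corrects_random_errors n SS Rec p \<epsilon> \<Longrightarrow> \<epsilon> \<le> \<epsilon>' \<Longrightarrow> corrects_random_errors n SS Rec p \<epsilon>'"
  unfolding corrects_random_errors_def by force

theorem proposition8p1:
  fixes p \<delta> :: real
  assumes "0 < p" and "p < 1/2" and "\<delta> > 0"
  shows "\<exists>c>0. \<forall>\<^sub>F n in sequentially.
           \<exists>SS Rec. sketch_pair n SS Rec
             \<and> has_entropy_loss n SS ((bin_entropy p + \<delta>) * real n)
             \<and> corrects_random_errors n SS Rec p (2 powr (- c * real n))"
proof -
  define \<eta> where "\<eta> = \<delta> / (2 * log 2 ((1 - p) / p))"
  have "\<eta> > 0" using assms by (auto simp: \<eta>_def field_simps intro!: divide_pos_pos)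
  \<comment> \<open>The smaller of the two exponential rates; dividing by \<open>ln 2\<close>
    converts the Hoeffding rate to base 2.\<close>
  define a where "a = min (2 * \<eta>\<^sup>2 / ln 2) (\<delta> / 2)"
  have a: "a > 0" using \<open>\<eta> > 0\<close> assms by (simp add: a_def)
  \<comment> \<open>Half of the rate \<open>a\<close> is given up to absorb the constant 3 = 1 + 2
    from adding the two error terms.\<close>
  have "filterlim (\<lambda>n. 2 powr (a / 2 * real n)) at_top sequentially"
    using a by real_asymp
  then have "\<forall>\<^sub>F n in sequentially. 3 \<le> 2 powr (a / 2 * real n)"
    by (simp add: filterlim_at_top)
  then have ev: "\<forall>\<^sub>F n in sequentially.
      \<exists>SS Rec. sketch_pair n SS Rec
        \<and> has_entropy_loss n SS ((bin_entropy p + \<delta>) * real n)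
        \<and> corrects_random_errors n SS Rec p (2 powr (- (a / 2) * real n))"
    using eventually_gt_at_top[of 0]
  proof eventually_elim
    case (elim n)
    have "a * n \<le> 2 * \<eta>\<^sup>2 / ln 2 * n" "a * n \<le> \<delta> / 2 * n"
      by (intro mult_right_mono; simp add: a_def)+
    then have "exp (- 2 * \<eta>\<^sup>2 * n) \<le> 2 powr (- a * n)"
      by (simp add: powr_def field_simps)
    moreover have "2 powr (- (\<delta> / 2) * n) \<le> 2 powr (- a * n)"
      using \<open>a * n \<le> \<delta> / 2 * n\<close> by (intro powr_mono) auto
    ultimately have "exp (- 2 * \<eta>\<^sup>2 * n) + 2 * 2 powr (- (\<delta> / 2) * n) \<le> 3 * 2 powr (- a * n)"
      by linarith
    also have "\<dots> \<le> 2 powr (a / 2 * n) * 2 powr (- a * n)"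
      using elim by (intro mult_right_mono) auto
    also have "\<dots> = 2 powr (- (a / 2) * n)"
      by (simp flip: powr_add)
    finally show ?case
      using ex_sketch[OF assms(1,2) elim(2) assms(3)] corrects_random_errors_mono
      unfolding \<eta>_def by blast
  qed
  then show ?thesis using a by (intro exI[of _ "a / 2"]) auto
qed

end
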